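(* Let $d,n$ be integers with $1<d\le n$. If $d$ is odd, then the elementary symmetric polynomial $X(d,n)$ over $GF(2)$ is not balanced.
   Context: For integers $1\le d\le n$, $X(d,n)=\sum_{1\le i_1<i_2<\cdots<i_d\le n}x_{i_1}x_{i_2}\cdots x_{i_d}$ is the elementary symmetric polynomial of degree $d$ in $n$ variables over $GF(2)$, viewed as a function $GF(2)^n\to GF(2)$. A function $f:GF(2)^n\to GF(2)$ is balanced if it takes each of the values $0$ and $1$ exactly $2^{n-1}$ times. *)

theory Defs
  imports Main "HOL-Library.FuncSet" "HOL-Library.Z2"
begin

text \<open>
  The type \<open>bit\<close> of \<open>HOL-Library.Z2\<close> is the field $GF(2)$. A point of $GF(2)^n$ is an extensional
  function on the index set \<open>{1..n}\<close>, so that there are exactly $2^n$ of them.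
\<close>

definition gf2_space :: "nat \<Rightarrow> (nat \<Rightarrow> bit) set" where
  "gf2_space n = {1..n} \<rightarrow>\<^sub>E UNIV"

text \<open>
  The increasing index tuples $1 \le i_1 < \cdots < i_d \le n$ are represented by the
  \<open>d\<close>-element subsets of \<open>{1..n}\<close>.
\<close>

definition X :: "nat \<Rightarrow> nat \<Rightarrow> (nat \<Rightarrow> bit) \<Rightarrow> bit" where
  "X d n x = (\<Sum>I | I \<subseteq> {1..n} \<and> card I = d. \<Prod>i\<in>I. x i)"

text \<open>Only meaningful for \<open>n \<ge> 1\<close>, because of the truncated subtraction in the exponent.\<close>

definition balanced :: "nat \<Rightarrow> ((nat \<Rightarrow> bit) \<Rightarrow> bit) \<Rightarrow> bool" where
  "balanced n f \<longleftrightarrow>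
     card {x \<in> gf2_space n. f x = 0} = 2 ^ (n - 1) \<and>
     card {x \<in> gf2_space n. f x = 1} = 2 ^ (n - 1)"

end

theory Submission
  imports Defs
begin

text \<open>
  On a point of Hamming weight \<open>w\<close>, the function \<open>X d n\<close> takes the value \<open>w choose d\<close> mod 2, which
  vanishes for even \<open>w\<close> because \<open>d * (w choose d) = w * (w - 1 choose d - 1)\<close> and \<open>d\<close> is odd.
  Flipping the first coordinate changes the parity of the weight, so it maps the ones of \<open>X d n\<close>
  injectively to zeros. The zero vector is a zero that is not hit: it is the flip of a point
  of weight \<open>1 < d\<close>, again a zero. Hence \<open>X d n\<close> has strictly more zeros than ones.
\<close>

lemma finite_gf2_space: "finite (gf2_space n)"
proof -
  have "(UNIV :: bit set) = {0, 1}"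
    by auto
  then have "finite (UNIV :: bit set)"
    by (metis finite.emptyI finite.insertI)
  then show ?thesis
    by (simp add: gf2_space_def finite_PiE)
qed

definition support :: "nat \<Rightarrow> (nat \<Rightarrow> bit) \<Rightarrow> nat set" where
  "support n x = {i \<in> {1..n}. x i = 1}"

lemma finite_support [simp]: "finite (support n x)"
  by (simp add: support_def)

text \<open>Over GF(2) a monomial is 1 exactly when all its variables are 1, so the sum counts, mod
  2, the \<open>d\<close>-subsets of the support.\<close>

lemma X_eq_choose: "X d n x = of_nat (card (support n x) choose d)"
proof -
  have prod_eq: "(\<Prod>i\<in>I. x i) = (if I \<subseteq> support n x then 1 else 0)" if "I \<subseteq> {1..n}" for I
  proof (cases "I \<subseteq> support n x")
    case True
    then show ?thesis
      by (auto simp: support_def intro!: prod.neutral)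
  next
    case False
    then obtain i where "i \<in> I" "x i \<noteq> 1"
      using \<open>I \<subseteq> {1..n}\<close> unfolding support_def by blast
    then have "i \<in> I" "x i = 0"
      by simp_all
    moreover have "finite I"
      using \<open>I \<subseteq> {1..n}\<close> finite_subset by blast
    ultimately show ?thesis
      using False by auto
  qed
  have "X d n x = (\<Sum>I | I \<subseteq> {1..n} \<and> card I = d. if I \<subseteq> support n x then 1 else 0)"
    unfolding X_def by (intro sum.cong) (auto simp: prod_eq)
  also have "\<dots> = (\<Sum>I | I \<subseteq> support n x \<and> card I = d. 1)"
    by (intro sum.mono_neutral_cong_right) (auto simp: support_def)
  also have "\<dots> = of_nat (card (support n x) choose d)"
    by (simp add: n_subsets)
  finally show ?thesis .
qed

lemma even_choose_odd:
  fixes m d :: nat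
  assumes "even m" and "odd d"
  shows "even (m choose d)"
proof -
  obtain k where "d = Suc k"
    using \<open>odd d\<close> by (cases d) auto
  \<comment> \<open>The absorption identity; at \<open>m = 0\<close> the truncated
    \<open>m - 1\<close> is harmless, since both sides are 0.\<close>
  then have "d * (m choose d) = m * (m - 1 choose k)"
    by (cases m) (simp_all add: Suc_times_binomial del: binomial_Suc_Suc mult_Suc)
  then show ?thesis
    using assms by (metis even_mult_iff)
qed

lemma of_nat_bit_even: "even k \<Longrightarrow> of_nat k = (0 :: bit)"
  by (auto elim!: evenE)

text \<open>Adding 1 toggles a bit. Coordinate 1 is an index whenever \<open>1 \<le> n\<close>, so
  the toggled point stays extensional on \<open>{1..n}\<close>.\<close>

definition flip :: "(nat \<Rightarrow> bit) \<Rightarrow> nat \<Rightarrow> bit" where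
  "flip x = x(1 := x 1 + 1)"

lemma flip_flip: "flip (flip x) = x"
  by (auto simp: flip_def fun_eq_iff)

lemma flip_in_gf2_space:
  assumes "1 \<le> n" and "x \<in> gf2_space n"
  shows "flip x \<in> gf2_space n"
  using assms by (auto simp: flip_def gf2_space_def PiE_iff extensional_def)

lemma even_card_support_flip:
  assumes "1 \<le> n"
  shows "even (card (support n (flip x))) \<longleftrightarrow> odd (card (support n x))"
proof (cases "x 1 = 1")
  case True
  then have "support n x = insert 1 (support n (flip x))" "1 \<notin> support n (flip x)"
    using assms by (auto simp: support_def flip_def)
  then show ?thesis
    by simp
next
  case False
  then have "support n (flip x) = insert 1 (support n x)" "1 \<notin> support n x"
    using assms by (auto simp: support_def flip_def)
  then show ?thesis
    by simp
qed

theorem lemma15: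
  fixes d n :: nat
  assumes "1 < d" and "d \<le> n" and "odd d"
  shows "\<not> balanced n (X d n)"
proof -
  let ?Z = "{x \<in> gf2_space n. X d n x = 0}" and ?O = "{x \<in> gf2_space n. X d n x = 1}"
  \<comment> \<open>The zero vector; \<open>restrict\<close> makes it \<open>undefined\<close>
    outside \<open>{1..n}\<close>, as membership in \<open>gf2_space n\<close> demands.\<close>
  define z :: "nat \<Rightarrow> bit" where "z = restrict (\<lambda>_. 0) {1..n}"
  have n: "1 \<le> n"
    using assms by simp
  have X_even: "X d n x = 0" if "even (card (support n x))" for x
    unfolding X_eq_choose using that \<open>odd d\<close> by (intro of_nat_bit_even even_choose_odd)
  have z: "z \<in> gf2_space n" "support n z = {}" "support n (flip z) = {1}"
    using n by (auto simp: z_def gf2_space_def support_def flip_def)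
  have "flip ` ?O \<subseteq> ?Z"
  proof clarify
    fix x assume "x \<in> gf2_space n" "X d n x = 1"
    \<comment> \<open>By contraposition of \<open>X_even\<close>, a point with value 1 has odd
      weight.\<close>
    moreover from this have "even (card (support n (flip x)))"
      using X_even[of x] by (auto simp: even_card_support_flip[OF n])
    ultimately show "flip x \<in> gf2_space n \<and> X d n (flip x) = 0"
      using X_even flip_in_gf2_space[OF n] by blast
  qed
  moreover have "z \<in> ?Z"
    using z X_even by simp
  moreover have "z \<notin> flip ` ?O"
  proof
    assume "z \<in> flip ` ?O"
    \<comment> \<open>As \<open>flip\<close> is an involution, a preimage of \<open>z\<close> can
      only be \<open>flip z\<close>. That point has weight 1, and \<open>1 choose d\<close> is 0 for
      \<open>1 < d\<close>.\<close>
    then have "X d n (flip z) = 1"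
      by (auto simp: flip_flip)
    then show False
      using z \<open>1 < d\<close> by (simp add: X_eq_choose binomial_eq_0)
  qed
  ultimately have "flip ` ?O \<subset> ?Z"
    by blast
  moreover have "finite ?Z"
    using finite_gf2_space by simp
  ultimately have "card (flip ` ?O) < card ?Z"
    by (simp add: psubset_card_mono)
  moreover have "card (flip ` ?O) = card ?O"
    by (intro card_image inj_on_inverseI[where g = flip]) (rule flip_flip)
  ultimately show ?thesis
    by (simp add: balanced_def)
qed

end
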